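(* Let $G$ be a finite simple undirected graph such that $R_{W_4}(G)$ is connected. Then $R_{W_4}(G)$ may be constructed by glueing copies of the graphs $\mathcal{L}_n$ ($n\in\mathbb{N}$) across free vertices: there is a finite disjoint union of partitioned graphs $\mathcal{L}_{n_1},\dots,\mathcal{L}_{n_m}$ and a finite sequence of glueings across pairs of distinct free vertices, starting from this disjoint union, whose result has underlying graph isomorphic to $R_{W_4}(G)$.
   Context: All graphs are finite, simple and undirected. $\mathbb{N}$ includes $0$. The operator $R_{W_4}$. The graph $W_4$ has vertices $p_1,p_2,p_3,p_4,q_1,q_2,q_3,q_4$ and edges $p_1p_2,\ p_2p_3,\ p_3p_4$ and $p_jq_j$ for $j=1,2,3,4$. Its endpoints are $p_1$ and $p_4$. $R_{W_4}(G)$ is obtained from $G$ by deleting each edge $\{u,v\}$ and adding a new disjoint copy of $W_4$ whose endpoints $p_1,p_4$ are identified with $u$ and $v$ respectively (the other six vertices of the copy are new). Partitioned graphs. A coloured graph is a graph $G$ with a map from $V(G)$ to a set of colours (not required to be proper). A vertex, and its colour, is free if no other vertex has the same colour. A partitioned graph is a coloured graph with a distinguished colour, the bound colour, such that every colour other than the bound colour is free; vertices of the bound colour are called bound. In a disjoint union of partitioned graphs the bound colours are identified and the free colours are kept distinct. The graph $\mathcal{L}_n$. It is the partitioned graph on $3n+1$ vertices $c$, $\ell_1,\dots,\ell_n$, $a_1,\dots,a_n$, $b_1,\dots,b_n$ with edges $c\ell_i$, $ca_i$ and $a_ib_i$ for $1\le i\le n$. The vertices $a_1,\dots,a_n$ are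 free (each has its own colour), and all other vertices are bound. For $n=0$ this is a single bound vertex. Glueing across free vertices. Given two distinct free vertices $v_1,v_2$ (belonging to the same or to different pieces), glueing across them means adding the edge $\{v_1,v_2\}$ (if not already present) and then making $v_1$ and $v_2$ bound; all other vertices keep their status. *)

theory Defs
  imports "Graph_Theory.Graph_Theory"
begin

text \<open>
  A finite simple undirected graph is a \<^term>\<open>pair_graph\<close>: a finite, loop-free digraph whose arcs
  are ordered pairs and which contains, with each arc, the reversed one. The edge \<open>{u,v}\<close> is thus
  represented by the two arcs \<open>(u,v)\<close> and \<open>(v,u)\<close>. \<open>ugraph V E\<close> is the graph whose edges are listed,
  in one direction each, in \<open>E\<close>.
\<close>

definition ugraph :: "'v set \<Rightarrow> 'v rel \<Rightarrow> 'v pair_pre_digraph" where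
  "ugraph V E = \<lparr> pverts = V, parcs = E \<union> E\<inverse> \<rparr>"

datatype w4_vertex = P1 | P2 | P3 | P4 | Q1 | Q2 | Q3 | Q4

definition W4 :: "w4_vertex pair_pre_digraph" where
  "W4 = ugraph {P1, P2, P3, P4, Q1, Q2, Q3, Q4}
     {(P1, P2), (P2, P3), (P3, P4), (P1, Q1), (P2, Q2), (P3, Q3), (P4, Q4)}"

text \<open>
  To say which end of an edge is identified with \<open>P1\<close> and which with \<open>P4\<close>, an orientation of the
  graph is chosen: \<open>D\<close> contains exactly one of the two arcs of every edge.
\<close>

definition orientation :: "'a pair_pre_digraph \<Rightarrow> 'a rel \<Rightarrow> bool" where
  "orientation G D \<longleftrightarrow> D \<union> D\<inverse> = parcs G \<and> D \<inter> D\<inverse> = {}"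

datatype 'a rw4_vertex = Old 'a | New "'a \<times> 'a" w4_vertex

text \<open>The copy of \<^term>\<open>W4\<close> that replaces the edge \<open>e\<close>, oriented from \<open>fst e\<close> to \<open>snd e\<close>.\<close>

definition place :: "'a \<times> 'a \<Rightarrow> w4_vertex \<Rightarrow> 'a rw4_vertex" where
  "place e w = (if w = P1 then Old (fst e) else if w = P4 then Old (snd e) else New e w)"

definition R_W4 :: "'a pair_pre_digraph \<Rightarrow> 'a rel \<Rightarrow> 'a rw4_vertex pair_pre_digraph" where
  "R_W4 G D = \<lparr>
     pverts = Old ` pverts G \<union> (\<Union>e\<in>D. place e ` pverts W4),
     parcs = (\<Union>e\<in>D. map_prod (place e) (place e) ` parcs W4) \<rparr>"

record ('v, 'c) coloured_graph =
  graph_of :: "'v pair_pre_digraph"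
  colour :: "'v \<Rightarrow> 'c"

record ('v, 'c) partitioned_graph = "('v, 'c) coloured_graph" +
  bound_colour :: 'c

definition free_vertex :: "('v, 'c, 'z) coloured_graph_scheme \<Rightarrow> 'v \<Rightarrow> bool" where
  "free_vertex P v \<longleftrightarrow> v \<in> pverts (graph_of P) \<and>
     (\<forall>w \<in> pverts (graph_of P). colour P w = colour P v \<longrightarrow> w = v)"

definition bound_vertex :: "('v, 'c) partitioned_graph \<Rightarrow> 'v \<Rightarrow> bool" where
  "bound_vertex P v \<longleftrightarrow> v \<in> pverts (graph_of P) \<and> colour P v = bound_colour P"

definition is_partitioned_graph :: "('v, 'c) partitioned_graph \<Rightarrow> bool" where
  "is_partitioned_graph P \<longleftrightarrow> pair_graph (graph_of P) \<and>
     (\<forall>v \<in> pverts (graph_of P). colour P v \<noteq> bound_colour P \<longrightarrow> free_vertex P v)"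

datatype L_vertex = C | Leaf nat | A nat | B nat

definition L_graph :: "nat \<Rightarrow> (L_vertex, nat option) partitioned_graph" where
  "L_graph n = \<lparr>
     graph_of = ugraph ({C} \<union> Leaf ` {1..n} \<union> A ` {1..n} \<union> B ` {1..n})
       (\<Union>i\<in>{1..n}. {(C, Leaf i), (C, A i), (A i, B i)}),
     colour = (\<lambda>v. case v of A i \<Rightarrow> Some i | _ \<Rightarrow> None),
     bound_colour = None \<rparr>"

text \<open>
  In the disjoint union \<open>None\<close> is the common bound colour and \<open>Some (i, c)\<close> is the colour \<open>c\<close> of the
  \<open>i\<close>-th piece.
\<close>

definition disjoint_union ::
  "('v, 'c) partitioned_graph list \<Rightarrow> (nat \<times> 'v, (nat \<times> 'c) option) partitioned_graph" where
  "disjoint_union Ps = \<lparr>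
     graph_of = \<lparr>
       pverts = {(i, v). i < length Ps \<and> v \<in> pverts (graph_of (Ps ! i))},
       parcs = {((i, u), (i, v)) | i u v. i < length Ps \<and> (u, v) \<in> parcs (graph_of (Ps ! i))} \<rparr>,
     colour = (\<lambda>(i, v). if colour (Ps ! i) v = bound_colour (Ps ! i) then None
                        else Some (i, colour (Ps ! i) v)),
     bound_colour = None \<rparr>"

definition glue :: "('v, 'c) partitioned_graph \<Rightarrow> 'v \<Rightarrow> 'v \<Rightarrow> ('v, 'c) partitioned_graph" where
  "glue P v1 v2 = P \<lparr>
     graph_of := \<lparr> pverts = pverts (graph_of P),
                   parcs = parcs (graph_of P) \<union> {(v1, v2), (v2, v1)} \<rparr>,
     colour := (colour P)(v1 := bound_colour P, v2 := bound_colour P) \<rparr>"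

text \<open>
  A vertex that happens to be the only bound one (such as the vertex of \<open>L_graph 0\<close>) satisfies
  \<^term>\<open>free_vertex\<close> but is not available for glueing, hence the explicit exclusion of bound vertices.
\<close>

definition glue_step :: "('v, 'c) partitioned_graph \<Rightarrow> ('v, 'c) partitioned_graph \<Rightarrow> bool" where
  "glue_step P P' \<longleftrightarrow> (\<exists>v1 v2. v1 \<noteq> v2 \<and>
     free_vertex P v1 \<and> \<not> bound_vertex P v1 \<and>
     free_vertex P v2 \<and> \<not> bound_vertex P v2 \<and> P' = glue P v1 v2)"

lemma pair_graphI:
  assumes "finite (pverts G)" "\<And>u v. (u, v) \<in> parcs G \<Longrightarrow> u \<in> pverts G \<and> v \<in> pverts G \<and> u \<noteq> v"
    "\<And>u v. (u, v) \<in> parcs G \<Longrightarrow> (v, u) \<in> parcs G"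
  shows "pair_graph G"
proof -
  have "parcs G \<subseteq> pverts G \<times> pverts G" using assms(2) by auto
  then have "finite (parcs G)" using assms(1) finite_subset by blast
  then show ?thesis
    by unfold_locales (use assms in \<open>auto simp: symmetric_def intro!: symI\<close>)
qed

lemma pair_graphD:
  assumes "pair_graph G"
  shows "finite (pverts G)" "\<And>u v. (u, v) \<in> parcs G \<Longrightarrow> u \<in> pverts G \<and> v \<in> pverts G \<and> u \<noteq> v"
    "\<And>u v. (u, v) \<in> parcs G \<Longrightarrow> (v, u) \<in> parcs G"
proof -
  interpret pair_graph G by fact
  show "finite (pverts G)" by simp
  show "(u, v) \<in> parcs G \<Longrightarrow> u \<in> pverts G \<and> v \<in> pverts G \<and> u \<noteq> v" for u v
    using arc_fst_in_verts arc_snd_in_verts pair_no_loops by force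
  show "(u, v) \<in> parcs G \<Longrightarrow> (v, u) \<in> parcs G" for u v
    using pair_sym_arcs by (auto simp: symmetric_def dest: symD)
qed

lemma orientation_exists:
  assumes "pair_graph G"
  shows "\<exists>D. orientation G D"
proof -
  note G = pair_graphD[OF assms]
  obtain f :: "_ \<Rightarrow> nat" where f: "inj_on f (pverts G)"
    using finite_imp_inj_to_nat_seg[OF G(1)] by blast
  have "orientation G {(u, v) \<in> parcs G. f u < f v}"
    unfolding orientation_def using G(2,3) inj_onD[OF f]
    by (auto simp: set_eq_iff) (metis linorder_neqE_nat)+
  then show ?thesis ..
qed

lemma pair_graph_W4: "pair_graph W4"
  by (rule pair_graphI) (auto simp: W4_def ugraph_def)

lemma pair_graph_R_W4:
  assumes "pair_graph G" "orientation G D"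
  shows "pair_graph (R_W4 G D)"
proof -
  note G = pair_graphD[OF assms(1)]
  have D: "(u, v) \<in> D \<Longrightarrow> (u, v) \<in> parcs G" for u v
    using assms(2) by (auto simp: orientation_def)
  have "D \<subseteq> pverts G \<times> pverts G" using D G(2) by fastforce
  then have "finite D" using G(1) finite_subset by blast
  note W = pair_graphD[OF pair_graph_W4]
  have inj: "w = w'" if "fst e \<noteq> snd e" "place e w = place e w'" for e :: "'a \<times> 'a" and w w'
    using that by (auto simp: place_def split: if_splits)
  show ?thesis
  proof (rule pair_graphI)
    show "finite (pverts (R_W4 G D))"
      using \<open>finite D\<close> G(1) W(1) by (simp add: R_W4_def)
  next
    fix x y assume "(x, y) \<in> parcs (R_W4 G D)"
    then obtain e w w' where e: "e \<in> D" "(w, w') \<in> parcs W4" "x = place e w" "y = place e w'"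
      by (auto simp: R_W4_def)
    have "fst e \<noteq> snd e" using D[of "fst e" "snd e"] e(1) G(2) by simp
    then have "x \<noteq> y" using W(2)[OF e(2)] inj e(3,4) by blast
    moreover have "x \<in> pverts (R_W4 G D)" "y \<in> pverts (R_W4 G D)"
      using e W(2)[OF e(2)] by (auto simp: R_W4_def)
    ultimately show "x \<in> pverts (R_W4 G D) \<and> y \<in> pverts (R_W4 G D) \<and> x \<noteq> y" by blast
    have "(y, x) = map_prod (place e) (place e) (w', w)" using e by simp
    then show "(y, x) \<in> parcs (R_W4 G D)"
      using e(1) W(3)[OF e(2)] unfolding R_W4_def by (auto intro!: bexI[of _ e])
  qed
qed

lemma is_partitioned_graph_L: "is_partitioned_graph (L_graph n)"
  unfolding is_partitioned_graph_def
  by (intro conjI pair_graphI) (auto simp: L_graph_def ugraph_def free_vertex_def split: L_vertex.splits)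

lemma is_partitioned_graph_disjoint_union:
  assumes "\<And>P. P \<in> set Ps \<Longrightarrow> is_partitioned_graph P"
  shows "is_partitioned_graph (disjoint_union Ps)"
proof -
  have P: "i < length Ps \<Longrightarrow> is_partitioned_graph (Ps ! i)" for i using assms by simp
  have V: "pverts (graph_of (disjoint_union Ps)) = Sigma {..<length Ps} (\<lambda>i. pverts (graph_of (Ps ! i)))"
    by (auto simp: disjoint_union_def)
  have "pair_graph (graph_of (disjoint_union Ps))"
  proof (rule pair_graphI)
    show "finite (pverts (graph_of (disjoint_union Ps)))"
      unfolding V using P by (auto simp: is_partitioned_graph_def dest: pair_graphD(1))
  next
    fix x y assume "(x, y) \<in> parcs (graph_of (disjoint_union Ps))"
    then obtain i u v where i: "x = (i, u)" "y = (i, v)" "i < length Ps" "(u, v) \<in> parcs (graph_of (Ps ! i))"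
      by (auto simp: disjoint_union_def)
    have g: "pair_graph (graph_of (Ps ! i))" using P i by (simp add: is_partitioned_graph_def)
    show "x \<in> pverts (graph_of (disjoint_union Ps)) \<and> y \<in> pverts (graph_of (disjoint_union Ps)) \<and> x \<noteq> y"
      using i pair_graphD(2)[OF g i(4)] by (simp add: disjoint_union_def)
    show "(y, x) \<in> parcs (graph_of (disjoint_union Ps))"
      using i pair_graphD(3)[OF g i(4)] by (simp add: disjoint_union_def)
  qed
  then show ?thesis
    using P unfolding is_partitioned_graph_def
    by (auto simp: disjoint_union_def free_vertex_def split: if_splits)
qed

lemma is_partitioned_graph_glue_step:
  assumes "is_partitioned_graph P" "glue_step P P'"
  shows "is_partitioned_graph P'"
proof -
  from assms(2) obtain v1 v2 where v: "v1 \<noteq> v2" "free_vertex P v1" "free_vertex P v2"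
    and P': "P' = glue P v1 v2"
    by (auto simp: glue_step_def)
  have "pair_graph (graph_of P')"
    using assms(1) v unfolding P'
    by (intro pair_graphI)
       (auto simp: glue_def is_partitioned_graph_def free_vertex_def dest: pair_graphD)
  then show ?thesis
    using assms(1) v unfolding P' is_partitioned_graph_def
    by (auto simp: glue_def free_vertex_def split: if_splits)
qed

end

theory Submission
  imports Defs
begin

text \<open>
  Call the arcs of \<open>G\<close> \<^emph>\<open>darts\<close>: an edge \<open>{u, v}\<close> consists of the dart \<open>(u, v)\<close> at \<open>u\<close> and the dart
  \<open>(v, u)\<close> at \<open>v\<close>. The copy of \<open>W4\<close> on an edge falls into two halves when its middle edge
  \<open>P2 P3\<close> is cut, and each half belongs to one dart: the half at \<open>P1\<close> contributes the pendant vertex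
  \<open>Q1\<close> and the path \<open>P2, Q2\<close> to its end, and the half at \<open>P4\<close> contributes \<open>Q4\<close> and \<open>P3, Q3\<close> in the
  same way. So, once all the middle edges are cut, what remains around an old vertex \<open>u\<close> of degree \<open>n\<close>
  is \<open>n\<close> pendant vertices and \<open>n\<close> paths of length two attached to \<open>u\<close>, which is exactly
  \<open>L_graph n\<close> with centre \<open>u\<close>. The vertices incident with the cut edges are the free vertices
  \<open>A k\<close>, one for each dart, and the two darts of an edge pair them up. Restoring the middle edges is
  therefore glueing across a perfect matching of the free vertices.

  This is carried out by numbering the vertices of \<open>G\<close> and the darts at each vertex
  (\<open>numbering_of_arcs\<close>), and by writing both graphs as families indexed by darts
  (\<open>pverts_R_W4\<close>, \<open>parcs_R_W4\<close> and \<open>pverts_union_L\<close>, \<open>parcs_union_L\<close>), which turns the isomorphism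
  into a comparison of index sets. The lemma \<open>glue_along_matching\<close> performs the glueings.
\<close>

section \<open>Isomorphisms of pair digraphs\<close>

lemma digraph_iso_with_projI:
  assumes "wf_digraph (with_proj G)" and "inj_on f (pverts G)"
    and "f ` pverts G = pverts H" and "map_prod f f ` parcs G = parcs H"
  shows "digraph_iso (with_proj G) (with_proj H)"
proof -
  let ?h = "\<lparr> iso_verts = f, iso_arcs = map_prod f f, iso_head = snd, iso_tail = fst \<rparr>"
  interpret wf_digraph "with_proj G" by fact
  have sub: "parcs G \<subseteq> pverts G \<times> pverts G"
    using tail_in_verts head_in_verts by force
  have "inj_on (map_prod f f) (parcs G)"
    using map_prod_inj_on[OF assms(2,2)] sub inj_on_subset by blast
  then have "pre_digraph.digraph_isomorphism (with_proj G) ?h"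
    unfolding digraph_isomorphism_def using assms(1,2) by simp
  moreover have "with_proj H = app_iso ?h (with_proj G)"
    using assms(3,4) by (simp add: app_iso_def with_proj_def)
  ultimately show ?thesis unfolding digraph_iso_def by blast
qed

lemma map_prod_image_converse: "map_prod f f ` (S\<inverse>) = (map_prod f f ` S)\<inverse>"
  by (force simp: image_iff)

section \<open>Glueing along a matching\<close>

text \<open>
  The pairs to be glued are \<open>(x e, y e)\<close> for \<open>e \<in> I\<close>. Since all these vertices are distinct, a glueing
  does not affect the freeness of the vertices that are still to be used; the description of the final
  colouring is included so that the induction can see this.
\<close>

lemma glue_along_matching:
  fixes P :: "('v, 'c) partitioned_graph"
  assumes "finite I" and "inj_on x I" and "inj_on y I" and "x ` I \<inter> y ` I = {}"
    and "\<And>v. v \<in> x ` I \<union> y ` I \<Longrightarrow> free_vertex P v \<and> \<not> bound_vertex P v"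
  defines "M \<equiv> (\<lambda>e. (x e, y e)) ` I"
  shows "\<exists>H. glue_step\<^sup>*\<^sup>* P H \<and>
    graph_of H = \<lparr> pverts = pverts (graph_of P), parcs = parcs (graph_of P) \<union> (M \<union> M\<inverse>) \<rparr> \<and>
    bound_colour H = bound_colour P \<and>
    colour H = (\<lambda>v. if v \<in> x ` I \<union> y ` I then bound_colour P else colour P v)"
  using assms(1-5) unfolding M_def
proof (induction I rule: finite_induct)
  case empty
  show ?case by (intro exI[of _ P]) auto
next
  case (insert e I)
  then obtain H where H: "glue_step\<^sup>*\<^sup>* P H"
    "graph_of H = \<lparr> pverts = pverts (graph_of P), parcs = parcs (graph_of P) \<union>
       ((\<lambda>e. (x e, y e)) ` I \<union> ((\<lambda>e. (x e, y e)) ` I)\<inverse>) \<rparr>"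
    "bound_colour H = bound_colour P"
    "colour H = (\<lambda>v. if v \<in> x ` I \<union> y ` I then bound_colour P else colour P v)"
    by auto
  have new: "x e \<notin> x ` I \<union> y ` I" "y e \<notin> x ` I \<union> y ` I" "x e \<noteq> y e"
    using insert.hyps(2) insert.prems(1-3) by auto
  have "free_vertex H v \<and> \<not> bound_vertex H v" if "v \<in> {x e, y e}" for v
    using insert.prems(4)[of v] new that
    by (auto simp: free_vertex_def bound_vertex_def H split: if_splits)
  then have "glue_step H (glue H (x e) (y e))"
    using new(3) unfolding glue_step_def by blast
  with H(1) have "glue_step\<^sup>*\<^sup>* P (glue H (x e) (y e))" by simp
  then show ?case
    by (intro exI[of _ "glue H (x e) (y e)"]) (auto simp: glue_def H fun_eq_iff)
qed

section \<open>Numbering the darts of a graph\<close>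

text \<open>
  The pair \<open>(i, k)\<close> stands for the \<open>k\<close>-th arc that leaves the \<open>i\<close>-th vertex, so \<open>ns\<close> is the list of
  outdegrees. Arcs are counted from 1 in order to match the indices of \<open>L_graph\<close>.
\<close>

lemma numbering_of_arcs:
  fixes R :: "'a rel"
  assumes "finite V" and "R \<subseteq> V \<times> V"
  obtains vs :: "'a list" and ns :: "nat list" and \<phi> :: "nat \<times> nat \<Rightarrow> 'a \<times> 'a"
  where "length ns = length vs" and "bij_betw ((!) vs) {..<length vs} V"
    and "bij_betw \<phi> (SIGMA i:{..<length vs}. {1..ns ! i}) R"
    and "\<And>i k. fst (\<phi> (i, k)) = vs ! i"
proof -
  obtain vs where vs: "set vs = V" "distinct vs"
    using finite_distinct_list[OF assms(1)] by blast
  have fin: "finite (R `` {u})" for u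
    using assms by (auto intro: finite_subset[of _ V])
  obtain nb :: "'a \<Rightarrow> nat \<Rightarrow> 'a" where nb: "\<And>u. bij_betw (nb u) {1..card (R `` {u})} (R `` {u})"
    using ex_bij_betw_nat_finite_1[OF fin] by metis
  define ns where "ns = map (\<lambda>u. card (R `` {u})) vs"
  define \<phi> where "\<phi> = (\<lambda>(i, k). (vs ! i, nb (vs ! i) k))"
  have bvs: "bij_betw ((!) vs) {..<length vs} V"
    by (rule bij_betw_nth) (use vs in auto)
  have inj: "inj_on \<phi> (SIGMA i:{..<length vs}. {1..ns ! i})"
  proof (rule inj_onI)
    fix d d' assume "d \<in> (SIGMA i:{..<length vs}. {1..ns ! i})"
      "d' \<in> (SIGMA i:{..<length vs}. {1..ns ! i})" "\<phi> d = \<phi> d'"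
    moreover obtain i k j l where "d = (i, k)" "d' = (j, l)"
      by (cases d, cases d')
    ultimately have a: "i < length vs" "j < length vs" "vs ! i = vs ! j" "d = (i, k)" "d' = (j, l)"
      "k \<in> {1..card (R `` {vs ! i})}" "l \<in> {1..card (R `` {vs ! j})}"
      "nb (vs ! i) k = nb (vs ! j) l"
      by (auto simp: \<phi>_def ns_def)
    have "i = j"
      using a(1-3) inj_onD[OF bij_betw_imp_inj_on[OF bvs]] by auto
    moreover have "k = l"
      using a(3,6-8) inj_onD[OF bij_betw_imp_inj_on[OF nb[of "vs ! i"]], of k l] by simp
    ultimately show "d = d'" using a by simp
  qed
  have "\<phi> ` (SIGMA i:{..<length vs}. {1..ns ! i}) = R"
  proof (intro equalityI subsetI)
    fix e assume "e \<in> \<phi> ` (SIGMA i:{..<length vs}. {1..ns ! i})"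
    then obtain i k where "i < length vs" "k \<in> {1..card (R `` {vs ! i})}"
      "e = (vs ! i, nb (vs ! i) k)"
      by (auto simp: \<phi>_def ns_def)
    then show "e \<in> R" using bij_betwE[OF nb[of "vs ! i"]] by auto
  next
    fix e assume "e \<in> R"
    then obtain i where i: "i < length vs" "fst e = vs ! i"
      using assms(2) vs(1) by (metis in_set_conv_nth mem_Times_iff subset_eq)
    then have "snd e \<in> R `` {vs ! i}" using \<open>e \<in> R\<close> by (cases e) auto
    then obtain k where "k \<in> {1..card (R `` {vs ! i})}" "snd e = nb (vs ! i) k"
      using bij_betw_imp_surj_on[OF nb[of "vs ! i"]] by blast
    then show "e \<in> \<phi> ` (SIGMA i:{..<length vs}. {1..ns ! i})"
      using i by (intro image_eqI[of _ _ "(i, k)"]) (auto simp: \<phi>_def ns_def prod_eq_iff)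
  qed
  with inj have "bij_betw \<phi> (SIGMA i:{..<length vs}. {1..ns ! i}) R"
    by (simp add: bij_betw_def)
  then show thesis
    using that[of ns vs \<phi>] bvs by (simp add: ns_def \<phi>_def)
qed

section \<open>Both graphs as families indexed by darts\<close>

text \<open>
  For a dart \<open>e\<close>, the half of the copy of \<open>W4\<close> that lies at the vertex \<open>fst e\<close> is its \<open>P1\<close> half if the
  edge is oriented along \<open>e\<close>, and its \<open>P4\<close> half otherwise. The parameters \<open>a\<close> and \<open>b\<close> name the vertex
  in question in these two cases, and are always a pair exchanged by the reflection of \<open>W4\<close>:
  \<open>Q1, Q4\<close> or \<open>P2, P3\<close> or \<open>Q2, Q3\<close>.
\<close>

definition half :: "'a rel \<Rightarrow> w4_vertex \<Rightarrow> w4_vertex \<Rightarrow> 'a \<times> 'a \<Rightarrow> 'a rw4_vertex" where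
  "half D a b e = (if e \<in> D then New e a else New (prod.swap e) b)"

lemma half_swap:
  assumes "orientation G D" and "e \<in> D"
  shows "half D a b e = New e a" and "half D a b (prod.swap e) = New e b"
  using assms by (cases e; auto simp: half_def orientation_def)+

text \<open>
  The side conditions say that no vertex of the \<open>P1\<close> half is confused with one of the \<open>P4\<close> half; so the
  vertex of \<open>W4\<close> alone tells which half it lies in, and the dart can be recovered.
\<close>

lemma half_eq_iff:
  assumes "a \<noteq> b'" and "b \<noteq> a'"
  shows "half D a b e = half D a' b' e' \<longleftrightarrow>
     e = e' \<and> (if e \<in> D then a = a' else b = b')"
  using assms by (auto simp: half_def dest: arg_cong[of _ _ prod.swap])

lemma UN_arcs_orientation:
  assumes "orientation G D"
  shows "(\<Union>e\<in>parcs G. F e) = (\<Union>e\<in>D. F e \<union> F (prod.swap e))"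
proof -
  have "parcs G = D \<union> prod.swap ` D"
    using assms by (force simp: orientation_def)
  then show ?thesis by auto
qed

lemma pverts_R_W4:
  assumes "pair_graph G" and "orientation G D"
  shows "pverts (R_W4 G D) = Old ` pverts G \<union>
    (\<Union>e\<in>parcs G. {half D Q1 Q4 e, half D P2 P3 e, half D Q2 Q3 e})"
proof -
  have "fst e \<in> pverts G \<and> snd e \<in> pverts G" if "e \<in> D" for e
    using that assms(2) pair_graphD(2)[OF assms(1), of "fst e" "snd e"]
    by (auto simp: orientation_def)
  then show ?thesis
    unfolding UN_arcs_orientation[OF assms(2)]
    by (auto simp: R_W4_def W4_def ugraph_def place_def half_swap[OF assms(2)])
qed

lemma parcs_R_W4:
  assumes "orientation G D"
  defines "T \<equiv> (\<Union>e\<in>parcs G. {(Old (fst e), half D Q1 Q4 e), (Old (fst e), half D P2 P3 e),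
      (half D P2 P3 e, half D Q2 Q3 e)}) \<union> (\<lambda>e. (New e P2, New e P3)) ` D"
  shows "parcs (R_W4 G D) = T \<union> T\<inverse>"
proof -
  have "T = (\<Union>e\<in>D. map_prod (place e) (place e) `
     {(P1, Q1), (P1, P2), (P2, Q2), (P2, P3)} \<union>
     {(place e P4, place e Q4), (place e P4, place e P3), (place e P3, place e Q3)})"
    unfolding T_def UN_arcs_orientation[OF assms(1)]
    by (auto simp: place_def half_swap[OF assms(1)])
  then show ?thesis
    by (auto simp: R_W4_def W4_def ugraph_def)
qed

definition dart_indices :: "nat list \<Rightarrow> (nat \<times> nat) set" where
  "dart_indices ns = (SIGMA i:{..<length ns}. {1..ns ! i})"

lemma pverts_union_L:
  "pverts (graph_of (disjoint_union (map L_graph ns))) = (\<lambda>i. (i, C)) ` {..<length ns} \<union>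
    (\<Union>(i, k)\<in>dart_indices ns. {(i, Leaf k), (i, A k), (i, B k)})"
  by (force simp: disjoint_union_def L_graph_def ugraph_def dart_indices_def)

lemma parcs_union_L:
  fixes ns :: "nat list"
  defines "S \<equiv> \<Union>(i, k)\<in>dart_indices ns. {((i, C), (i, Leaf k)), ((i, C), (i, A k)), ((i, A k), (i, B k))}"
  shows "parcs (graph_of (disjoint_union (map L_graph ns))) = S \<union> S\<inverse>"
  unfolding S_def by (force simp: disjoint_union_def L_graph_def ugraph_def dart_indices_def)

lemma free_A_union_L:
  assumes "(i, k) \<in> dart_indices ns"
  defines "P \<equiv> disjoint_union (map L_graph ns)"
  shows "free_vertex P (i, A k) \<and> \<not> bound_vertex P (i, A k)"
  using assms(1) unfolding P_def
  by (auto simp: free_vertex_def bound_vertex_def disjoint_union_def L_graph_def ugraph_def dart_indices_def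
      split: L_vertex.splits)

section \<open>Decomposition into the pieces\<close>

theorem proposition4p2:
  fixes G :: "'a pair_pre_digraph" and D :: "'a rel"
  assumes "pair_graph G"
    and "orientation G D"
    and "connected (with_proj (R_W4 G D))"
  shows "\<exists>(ns :: nat list) H.
    glue_step\<^sup>*\<^sup>* (disjoint_union (map L_graph ns)) H \<and>
    digraph_iso (with_proj (graph_of H)) (with_proj (R_W4 G D))"
proof -
  have arcs_sub: "parcs G \<subseteq> pverts G \<times> pverts G"
    using pair_graphD(2)[OF assms(1)] by auto
  obtain vs ns \<phi> where len: "length ns = length vs"
    and vs: "bij_betw ((!) vs) {..<length vs} (pverts G)"
    and \<phi>: "bij_betw \<phi> (dart_indices ns) (parcs G)"
    and fst_\<phi>: "\<And>i k. fst (\<phi> (i, k)) = vs ! i"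
  proof (rule numbering_of_arcs[OF pair_graphD(1)[OF assms(1)] arcs_sub])
    fix vs :: "'a list" and ns :: "nat list" and \<phi> :: "nat \<times> nat \<Rightarrow> 'a \<times> 'a"
    assume "length ns = length vs" "bij_betw ((!) vs) {..<length vs} (pverts G)"
      "bij_betw \<phi> (SIGMA i:{..<length vs}. {1..ns ! i}) (parcs G)" "\<And>i k. fst (\<phi> (i, k)) = vs ! i"
    then show thesis by (intro that[of ns vs \<phi>]) (simp_all add: dart_indices_def)
  qed
  define \<psi> where "\<psi> = the_inv_into (dart_indices ns) \<phi>"
  have \<psi>: "bij_betw \<psi> (parcs G) (dart_indices ns)"
    unfolding \<psi>_def by (rule bij_betw_the_inv_into[OF \<phi>])
  have \<phi>\<psi>: "\<phi> (\<psi> e) = e" if "e \<in> parcs G" for e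
    unfolding \<psi>_def using f_the_inv_into_f_bij_betw[OF \<phi>] that by auto
  have D_arcs: "e \<in> parcs G" "prod.swap e \<in> parcs G" if "e \<in> D" for e
    using that assms(2) by (cases e; auto simp: orientation_def)+
  have "D \<subseteq> pverts G \<times> pverts G" using D_arcs(1) arcs_sub by blast
  then have "finite D" using pair_graphD(1)[OF assms(1)] finite_subset by blast

  let ?P = "disjoint_union (map L_graph ns)"
  define nbr where "nbr = (\<lambda>e. (fst (\<psi> e), A (snd (\<psi> e))))"
  have inj_nbr: "inj_on nbr (parcs G)"
  proof (rule inj_onI)
    fix e e' assume e: "e \<in> parcs G" "e' \<in> parcs G" and "nbr e = nbr e'"
    then have "\<psi> e = \<psi> e'" by (simp add: nbr_def prod_eq_iff)
    then show "e = e'" using inj_onD[OF bij_betw_imp_inj_on[OF \<psi>]] e by blast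
  qed
  have free_nbr: "free_vertex ?P (nbr e) \<and> \<not> bound_vertex ?P (nbr e)" if "e \<in> parcs G" for e
    using free_A_union_L[of "fst (\<psi> e)" "snd (\<psi> e)" ns] bij_betwE[OF \<psi>] that
    by (simp add: nbr_def)
  \<comment> \<open>Each edge contributes one pair, namely the free vertices that belong to its two darts.\<close>
  define M where "M = (\<lambda>e. (nbr e, nbr (prod.swap e))) ` D"
  have "inj_on nbr D"
    using D_arcs(1) by (intro inj_on_subset[OF inj_nbr]) blast
  moreover have "inj_on (nbr \<circ> prod.swap) D"
    using D_arcs(2) by (intro comp_inj_on inj_on_subset[OF inj_nbr]) auto
  moreover have "nbr ` D \<inter> (nbr \<circ> prod.swap) ` D = {}"
  proof -
    have "nbr e \<noteq> nbr (prod.swap e')" if "e \<in> D" "e' \<in> D" for e e'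
    proof
      assume "nbr e = nbr (prod.swap e')"
      then have "e = prod.swap e'"
        using inj_onD[OF inj_nbr] D_arcs that by blast
      then show False
        using that assms(2) by (cases e') (auto simp: orientation_def)
    qed
    then show ?thesis unfolding comp_def by blast
  qed
  moreover have "free_vertex ?P v \<and> \<not> bound_vertex ?P v"
    if "v \<in> nbr ` D \<union> (nbr \<circ> prod.swap) ` D" for v
    using that free_nbr D_arcs by auto
  ultimately obtain H where H: "glue_step\<^sup>*\<^sup>* ?P H"
    and graph_H: "graph_of H =
      \<lparr> pverts = pverts (graph_of ?P), parcs = parcs (graph_of ?P) \<union> (M \<union> M\<inverse>) \<rparr>"
    using glue_along_matching[OF \<open>finite D\<close>, of nbr "nbr \<circ> prod.swap" ?P]
    unfolding M_def o_def by blast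
 
  \<comment> \<open>The isomorphism maps centres to old vertices and the \<open>k\<close>-th branch of the \<open>i\<close>-th piece to the
    half belonging to the dart \<open>\<phi> (i, k)\<close>.\<close>
  define f where "f = (\<lambda>(i, v). case v of
       C \<Rightarrow> Old (vs ! i)
     | Leaf k \<Rightarrow> half D Q1 Q4 (\<phi> (i, k))
     | A k \<Rightarrow> half D P2 P3 (\<phi> (i, k))
     | B k \<Rightarrow> half D Q2 Q3 (\<phi> (i, k)))"
  have f: "f (i, C) = Old (vs ! i)" "f (i, Leaf k) = half D Q1 Q4 (\<phi> (i, k))"
    "f (i, A k) = half D P2 P3 (\<phi> (i, k))" "f (i, B k) = half D Q2 Q3 (\<phi> (i, k))" for i k
    by (simp_all add: f_def)
  have f_nbr: "f (nbr e) = half D P2 P3 e" if "e \<in> parcs G" for e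
    using \<phi>\<psi>[OF that] by (simp add: f nbr_def)
  have fst_\<phi>': "fst (\<phi> d) = vs ! fst d" for d
    using fst_\<phi>[of "fst d" "snd d"] by simp
  have parcs_\<phi>: "parcs G = \<phi> ` dart_indices ns"
    using bij_betw_imp_surj_on[OF \<phi>] by simp

  have "f ` pverts (graph_of H) = pverts (R_W4 G D)"
  proof -
    have "(\<lambda>i. f (i, C)) ` {..<length ns} = Old ` pverts G"
      using bij_betw_imp_surj_on[OF vs] len by (auto simp: f)
    then show ?thesis
      unfolding pverts_R_W4[OF assms(1,2)] parcs_\<phi> graph_H
      by (simp add: pverts_union_L image_Un image_UN image_image case_prod_beta f)
  qed
  moreover have "map_prod f f ` parcs (graph_of H) = parcs (R_W4 G D)"
  proof -
    have "map_prod f f ` M = (\<lambda>e. (New e P2, New e P3)) ` D"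
      unfolding M_def image_image using D_arcs
      by (intro image_cong) (simp_all add: f_nbr half_swap[OF assms(2)])
    moreover have "map_prod f f ` (\<Union>(i, k)\<in>dart_indices ns.
         {((i, C), (i, Leaf k)), ((i, C), (i, A k)), ((i, A k), (i, B k))}) =
       (\<Union>e\<in>parcs G. {(Old (fst e), half D Q1 Q4 e), (Old (fst e), half D P2 P3 e),
         (half D P2 P3 e, half D Q2 Q3 e)})"
      unfolding parcs_\<phi> by (simp add: image_UN case_prod_beta f fst_\<phi>')
    ultimately show ?thesis
      unfolding graph_H parcs_R_W4[OF assms(2)]
      by (simp add: parcs_union_L image_Un map_prod_image_converse converse_Un Un_ac)
  qed
  moreover have "inj_on f (pverts (graph_of H))"
  proof -
    have vs_eq: "vs ! i = vs ! j \<longleftrightarrow> i = j" if "i < length ns" "j < length ns" for i j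
      using that inj_on_eq_iff[OF bij_betw_imp_inj_on[OF vs]] len by auto
    have \<phi>_eq: "\<phi> d = \<phi> d' \<longleftrightarrow> d = d'" if "d \<in> dart_indices ns" "d' \<in> dart_indices ns" for d d'
      using that inj_on_eq_iff[OF bij_betw_imp_inj_on[OF \<phi>]] by blast
    have Old_half: "Old u \<noteq> half D a b e" "half D a b e \<noteq> Old u" for u a b e
      by (simp_all add: half_def)
    have cases: thesis if "x \<in> pverts (graph_of H)"
      and "\<And>i. i < length ns \<Longrightarrow> x = (i, C) \<Longrightarrow> thesis"
      and "\<And>i k. (i, k) \<in> dart_indices ns \<Longrightarrow> x = (i, Leaf k) \<Longrightarrow> thesis"
      and "\<And>i k. (i, k) \<in> dart_indices ns \<Longrightarrow> x = (i, A k) \<Longrightarrow> thesis"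
      and "\<And>i k. (i, k) \<in> dart_indices ns \<Longrightarrow> x = (i, B k) \<Longrightarrow> thesis" for x thesis
      using that unfolding graph_H pverts_union_L by auto
    show ?thesis
    proof (rule inj_onI)
      fix x y assume x: "x \<in> pverts (graph_of H)" and y: "y \<in> pverts (graph_of H)" and "f x = f y"
      show "x = y"
        by (rule cases[OF x]; rule cases[OF y])
          (use \<open>f x = f y\<close> in \<open>simp_all add: f vs_eq \<phi>_eq half_eq_iff Old_half split: if_splits\<close>)
    qed
  qed
  moreover have "wf_digraph (with_proj (graph_of H))"
  proof -
    have "is_partitioned_graph ?P"
      by (rule is_partitioned_graph_disjoint_union) (auto simp: is_partitioned_graph_L)
    with H have "is_partitioned_graph H"
      by (induction rule: rtranclp_induct) (auto intro: is_partitioned_graph_glue_step)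
    then interpret pair_graph "graph_of H"
      by (simp add: is_partitioned_graph_def)
    show ?thesis by unfold_locales
  qed
  ultimately show ?thesis
    using H digraph_iso_with_projI by blast
qed

end
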